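(* Let $u_0$ be a Radon measure on $\mathbb{R}^d$ and let $$u(x,t)=\frac{1}{(4\pi t)^{d/2}}\int_{\mathbb{R}^d}e^{-|x-y|^2/4t}\,\mathrm{d}u_0(y),\qquad x\in\mathbb{R}^d,\ t>0.$$ (i) If $u_0\in\mathcal{M}_U(\mathbb{R}^d)$ then $u_0\in\mathcal{M}_0(\mathbb{R}^d)$, $u(t)\in L^\infty(\mathbb{R}^d)$ for all $t>0$, and for every $1\le q\le\infty$ $$\|u(t)\|_{L^q_U(\mathbb{R}^d)}\le M_0\Big(t^{-\frac d2(1-\frac1q)}+1\Big)\|u_0\|_{\mathcal{M}_U(\mathbb{R}^d)},$$ where $M_0$ is a constant. (ii) Conversely, assume that $0\le u_0\in\mathcal{M}_0(\mathbb{R}^d)$. If $0\le u(t_0)\in L^\infty(\mathbb{R}^d)$ for some $t_0>0$, then $u_0\in\mathcal{M}_U(\mathbb{R}^d)$; hence $u(t)\in L^\infty(\mathbb{R}^d)$ for all $t>0$.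
   Context: $\mathcal{M}_{\rm loc}(\mathbb{R}^d)$ is the set of (signed) Radon measures on $\mathbb{R}^d$, identified with the dual of $C_c(\mathbb{R}^d)$; $|\mu|=\mu^++\mu^-$ is the total variation measure. For $\varepsilon>0$, $\mathcal{M}_\varepsilon(\mathbb{R}^d)=\{\mu\in\mathcal{M}_{\rm loc}(\mathbb{R}^d):\int e^{-\varepsilon|x|^2}\,\mathrm{d}|\mu|(x)<\infty\}$ and $\mathcal{M}_0(\mathbb{R}^d)=\bigcap_{\varepsilon>0}\mathcal{M}_\varepsilon(\mathbb{R}^d)$. The space of uniform measures is $\mathcal{M}_U(\mathbb{R}^d)=\{\mu\in\mathcal{M}_{\rm loc}(\mathbb{R}^d):\|\mu\|_{\mathcal{M}_U(\mathbb{R}^d)}:=\sup_{x\in\mathbb{R}^d}|\mu|(B(x,1))<\infty\}$. For $1\le q\le\infty$, $L^q_U(\mathbb{R}^d)$ is the set of $\phi\in L^q_{\rm loc}(\mathbb{R}^d)$ with $\|\phi\|_{L^q_U(\mathbb{R}^d)}:=\sup_{x\in\mathbb{R}^d}\|\phi\|_{L^q(B(x,1))}<\infty$ (so $L^\infty_U=L^\infty$). Write $u(t)=u(\cdot,t)$. *)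

theory Defs
  imports "HOL-Probability.Essential_Supremum"
begin

section \<open>Signed Radon measures\<close>

text \<open>
  A signed Radon measure \<open>\<mu>\<close> on a Euclidean space need not be a set function on all Borel sets
  (\<open>\<mu>\<^sup>+\<close> and \<open>\<mu>\<^sup>-\<close> may both be infinite there), so \<open>\<mu>\<close> is given by its Jordan
  decomposition \<open>(\<mu>\<^sup>+, \<mu>\<^sup>-)\<close>: a pair of mutually singular positive Radon measures. Such pairs
  correspond bijectively to the dual of \<open>C\<^sub>c\<close>, the functional being \<open>f \<mapsto> \<integral>f d\<mu>\<^sup>+ - \<integral>f d\<mu>\<^sup>-\<close>.
\<close>

type_synonym 'a signed_measure = "'a measure \<times> 'a measure"

text \<open>On a Euclidean space every locally finite Borel measure is regular, so regularity need not
  be demanded separately.\<close>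

definition radon_measure :: "'a::euclidean_space measure \<Rightarrow> bool" where
  "radon_measure M \<longleftrightarrow> sets M = sets borel \<and> (\<forall>K. compact K \<longrightarrow> emeasure M K < \<infinity>)"

definition mutually_singular :: "'a::euclidean_space measure \<Rightarrow> 'a measure \<Rightarrow> bool" where
  "mutually_singular M N \<longleftrightarrow> (\<exists>A\<in>sets borel. emeasure M (- A) = 0 \<and> emeasure N A = 0)"

definition pos_part :: "'a signed_measure \<Rightarrow> 'a measure" where
  "pos_part \<mu> = fst \<mu>"

definition neg_part :: "'a signed_measure \<Rightarrow> 'a measure" where
  "neg_part \<mu> = snd \<mu>"

definition M_loc :: "'a::euclidean_space signed_measure set" where
  "M_loc = {\<mu>. radon_measure (pos_part \<mu>) \<and> radon_measure (neg_part \<mu>)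
              \<and> mutually_singular (pos_part \<mu>) (neg_part \<mu>)}"

definition total_variation :: "'a::euclidean_space signed_measure \<Rightarrow> 'a measure" where
  "total_variation \<mu> =
     measure_of UNIV (sets borel) (\<lambda>A. emeasure (pos_part \<mu>) A + emeasure (neg_part \<mu>) A)"

definition nonneg_measure :: "'a::euclidean_space signed_measure \<Rightarrow> bool" where
  "nonneg_measure \<mu> \<longleftrightarrow> (\<forall>A\<in>sets borel. emeasure (neg_part \<mu>) A = 0)"

definition signed_integral :: "'a signed_measure \<Rightarrow> ('a \<Rightarrow> real) \<Rightarrow> real" where
  "signed_integral \<mu> f = (\<integral>y. f y \<partial>pos_part \<mu>) - (\<integral>y. f y \<partial>neg_part \<mu>)"

definition M_eps :: "real \<Rightarrow> 'a::euclidean_space signed_measure set" where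
  "M_eps \<epsilon> = {\<mu> \<in> M_loc. (\<integral>\<^sup>+x. ennreal (exp (- \<epsilon> * (norm x)\<^sup>2)) \<partial>total_variation \<mu>) < \<infinity>}"

definition M_0 :: "'a::euclidean_space signed_measure set" where
  "M_0 = (\<Inter>\<epsilon>\<in>{0<..}. M_eps \<epsilon>)"

definition M_U_norm :: "'a::euclidean_space signed_measure \<Rightarrow> ennreal" where
  "M_U_norm \<mu> = (SUP x. emeasure (total_variation \<mu>) (ball x 1))"

definition M_U :: "'a::euclidean_space signed_measure set" where
  "M_U = {\<mu> \<in> M_loc. M_U_norm \<mu> < \<infinity>}"

lemma sets_total_variation: "sets (total_variation \<mu>) = sets borel"
  using sets.sigma_sets_eq[of "borel :: 'a::euclidean_space measure"]
  by (simp add: total_variation_def)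

lemma emeasure_total_variation:
  assumes "\<mu> \<in> M_loc" "A \<in> sets borel"
  shows "emeasure (total_variation \<mu>) A = emeasure (pos_part \<mu>) A + emeasure (neg_part \<mu>) A"
proof -
  let ?P = "pos_part \<mu>" and ?N = "neg_part \<mu>"
  have P: "sets ?P = sets borel" and N: "sets ?N = sets borel"
    using assms(1) by (auto simp: M_loc_def radon_measure_def)
  have "countably_additive (sets borel) (\<lambda>A. emeasure ?P A + emeasure ?N A)"
  proof (rule countably_additiveI)
    fix F :: "nat \<Rightarrow> 'a set"
    assume F: "range F \<subseteq> sets borel" "disjoint_family F"
    have "(\<Sum>i. emeasure ?P (F i) + emeasure ?N (F i))
        = (\<Sum>i. emeasure ?P (F i)) + (\<Sum>i. emeasure ?N (F i))"
      by (simp add: suminf_add[OF summableI summableI])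
    also have "\<dots> = emeasure ?P (\<Union>i. F i) + emeasure ?N (\<Union>i. F i)"
      using F P N by (simp add: suminf_emeasure)
    finally show "(\<Sum>i. emeasure ?P (F i) + emeasure ?N (F i))
        = emeasure ?P (\<Union>i. F i) + emeasure ?N (\<Union>i. F i)" .
  qed
  then show ?thesis
    unfolding total_variation_def using assms(2) sets.sigma_algebra_axioms[of "borel :: 'a measure"]
    by (intro emeasure_measure_of_sigma) (auto simp: positive_def)
qed

section \<open>Lebesgue spaces and their locally uniform versions\<close>

text \<open>The exponent ranges over \<open>[1, \<infinity>]\<close>, as a subset of \<^typ>\<open>ennreal\<close>; note that
  \<open>1 / \<infinity> = 0\<close> there. Functions are not quotiented by equality almost everywhere.\<close>

definition Lq_norm :: "ennreal \<Rightarrow> 'a::euclidean_space set \<Rightarrow> ('a \<Rightarrow> real) \<Rightarrow> ennreal" where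
  "Lq_norm q A f =
     (if q = \<infinity> then esssup (lebesgue_on A) (\<lambda>x. ennreal \<bar>f x\<bar>)
      else let I = \<integral>\<^sup>+x. ennreal (\<bar>f x\<bar> powr enn2real q) \<partial>lebesgue_on A
           in if I = \<infinity> then \<infinity> else ennreal (enn2real I powr enn2real (1 / q)))"

definition Lq :: "ennreal \<Rightarrow> 'a::euclidean_space set \<Rightarrow> ('a \<Rightarrow> real) set" where
  "Lq q A = {f \<in> borel_measurable (lebesgue_on A). Lq_norm q A f < \<infinity>}"

definition Lq_loc :: "ennreal \<Rightarrow> ('a::euclidean_space \<Rightarrow> real) set" where
  "Lq_loc q = {f. \<forall>K. compact K \<longrightarrow> f \<in> Lq q K}"

definition Lq_U_norm :: "ennreal \<Rightarrow> ('a::euclidean_space \<Rightarrow> real) \<Rightarrow> ennreal" where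
  "Lq_U_norm q f = (SUP x. Lq_norm q (ball x 1) f)"

definition Lq_U :: "ennreal \<Rightarrow> ('a::euclidean_space \<Rightarrow> real) set" where
  "Lq_U q = {f \<in> Lq_loc q. Lq_U_norm q f < \<infinity>}"

section \<open>The heat flow of a Radon measure\<close>

text \<open>The Bochner integrals converge whenever \<open>u\<^sub>0 \<in> M_0\<close>; outside of convergence they are \<open>0\<close>
  by convention.\<close>

definition heat_flow :: "'a::euclidean_space signed_measure \<Rightarrow> real \<Rightarrow> 'a \<Rightarrow> real" where
  "heat_flow u\<^sub>0 t x =
     1 / (4 * pi * t) powr (real DIM('a) / 2)
       * signed_integral u\<^sub>0 (\<lambda>y. exp (- (norm (x - y))\<^sup>2 / (4 * t)))"

end

theory Submission
  imports Defs "HOL-Probability.Distributions"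
begin

text \<open>
  Write \<open>u(t) = G\<^sub>t * u\<^sub>0\<close> with the Gaussian kernel \<open>G\<^sub>t\<close>, and let \<open>N\<close> be a bound for the mass
  that \<open>|u\<^sub>0|\<close> gives to unit balls. Since the positive and negative parts of \<open>u\<^sub>0\<close> produce nonnegative
  potentials, \<open>|u(t)|\<close> is at most \<open>G\<^sub>t * |u\<^sub>0|\<close>, so everything reduces to positive measures.

  Both endpoint estimates come from exchanging the order of integration.

  For the supremum, a measure with bounded mass on unit balls behaves, up to the factor
  \<open>N / |B(0,1)|\<close>, like Lebesgue measure on functions that vary little at unit scale
  (\<open>nn_integral_le_of_unit_ball_bound\<close>). Moving the argument of \<open>G\<^sub>t\<close> by less than \<open>1\<close> is paid for
  by doubling a time \<open>s \<ge> t\<close>, at the price of a factor \<open>e\<^bsup>1/(4s)\<^esup> (2s/t)\<^bsup>d/2\<^esup>\<close>. The choice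
  \<open>s = max t 1\<close> keeps the exponential bounded and gives \<open>|u(t)| \<le> C (t\<^bsup>-d/2\<^esup> + 1) N\<close>
  (\<open>abs_heat_flow_le_uniform\<close>).

  For the \<open>L\<^sup>1\<close> norm over a unit ball, \<open>G\<^sub>t * |u\<^sub>0|\<close> is an average, with weight \<open>G\<^sub>t\<close> of total mass
  \<open>1\<close>, of translates of \<open>|u\<^sub>0|\<close>, and each translate gives the ball mass at most \<open>N\<close>. Hence the local
  \<open>L\<^sup>1\<close> norm is at most \<open>N\<close> for every \<open>t\<close> (\<open>nn_integral_ball_heat_potential_le\<close>).

  Interpolating between the two endpoints gives the bound for \<open>1 \<le> q \<le> \<infinity>\<close> with one constant.
  Membership in \<open>M_0\<close> is the supremum bound at the origin, since \<open>e\<^bsup>-\<epsilon>|y|\<^sup>2\<^esup>\<close> is a multiple of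
  \<open>G\<^sub>t(0 - y)\<close> for \<open>t = 1/(4\<epsilon>)\<close>.

  For the converse (\<open>M_U_if_heat_flow_bounded\<close>), every unit ball contains a point \<open>x\<close> at which
  \<open>u(t\<^sub>0)\<close> does not exceed its essential bound, and \<open>G\<^bsub>t\<^sub>0\<^esub>(x - y)\<close> is bounded below for \<open>y\<close> in that
  ball; no cancellation occurs because \<open>u\<^sub>0 \<ge> 0\<close>, so the mass of the ball is controlled.
\<close>

section \<open>The Gaussian heat kernel\<close>

definition heat_kernel :: "real \<Rightarrow> 'a::euclidean_space \<Rightarrow> real" where
  "heat_kernel t x = exp (- (norm x)\<^sup>2 / (4 * t)) / (4 * pi * t) powr (real DIM('a) / 2)"

lemma heat_kernel_nonneg [simp]: "0 \<le> heat_kernel t x"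
  by (simp add: heat_kernel_def)

lemma borel_measurable_heat_kernel [measurable]: "heat_kernel t \<in> borel_measurable borel"
  unfolding heat_kernel_def[abs_def] by measurable

lemma heat_flow_eq_heat_kernel:
  "heat_flow \<mu> t x = (\<integral>y. heat_kernel t (x - y) \<partial>pos_part \<mu>) - (\<integral>y. heat_kernel t (x - y) \<partial>neg_part \<mu>)"
  by (simp add: heat_flow_def signed_integral_def heat_kernel_def diff_divide_distrib)

text \<open>The kernel is the product over the coordinates of centred normal densities of variance \<open>2t\<close>.\<close>

lemma nn_integral_heat_kernel:
  assumes "0 < t"
  shows "(\<integral>\<^sup>+x. ennreal (heat_kernel t (x::'a::euclidean_space)) \<partial>lborel) = 1"
proof -
  let ?\<phi> = "normal_density 0 (sqrt (2 * t))"
  have \<phi>: "?\<phi> s = exp (- s\<^sup>2 / (4 * t)) / sqrt (4 * pi * t)" for s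
    using assms by (simp add: normal_density_def mult.commute)
  have "heat_kernel t x = (\<Prod>b\<in>Basis. ?\<phi> (x \<bullet> b))" for x :: 'a
  proof -
    have "(4 * pi * t) powr (real DIM('a) / 2) = sqrt (4 * pi * t) ^ DIM('a)"
      using assms by (simp add: powr_half_sqrt_powr real_sqrt_power powr_realpow)
    moreover have "(\<Prod>b\<in>Basis. exp (- (x \<bullet> b)\<^sup>2 / (4 * t))) = exp (- (norm x)\<^sup>2 / (4 * t))"
      by (simp add: exp_sum[symmetric] power2_norm_eq_inner euclidean_inner[of x x] power2_eq_square[of "x \<bullet> _"] sum_negf sum_divide_distrib)
    ultimately show ?thesis
      by (simp add: \<phi> heat_kernel_def prod_dividef)
  qed
  then have "(\<integral>\<^sup>+x. ennreal (heat_kernel t (x::'a)) \<partial>lborel)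
      = (\<integral>\<^sup>+x. (\<Prod>b\<in>Basis. ennreal (?\<phi> (x \<bullet> b))) \<partial>(lborel::'a measure))"
    by (simp add: prod_ennreal)
  also have "\<dots> = (\<Prod>b\<in>(Basis::'a set). \<integral>\<^sup>+s. ennreal (?\<phi> s) \<partial>lborel)"
    by (rule nn_integral_lborel_prod) auto
  also have "(\<integral>\<^sup>+s. ennreal (?\<phi> s) \<partial>lborel) = 1"
    using assms by (subst nn_integral_eq_integral) (auto)
  finally show ?thesis by simp
qed

text \<open>
  A Harnack-type comparison: \<open>|x - z|\<^sup>2 \<le> 2|x - y|\<^sup>2 + 2\<close>, so a kernel at time \<open>2s\<close> absorbs a
  displacement of the argument. Two times \<open>t \<le> s\<close> appear because with \<open>s = t\<close> the factor
  \<open>e\<^bsup>1/(4s)\<^esup>\<close> would blow up as \<open>t \<rightarrow> 0\<close>.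
\<close>

lemma heat_kernel_le_of_dist_less_1:
  fixes x y z :: "'a::euclidean_space"
  assumes t: "0 < t" "t \<le> s" and yz: "dist y z < 1"
  shows "heat_kernel t (x - y)
    \<le> exp (1 / (4 * s)) * (2 * s / t) powr (real DIM('a) / 2) * heat_kernel (2 * s) (x - z)"
proof -
  let ?d = "real DIM('a) / 2"
  have "norm (x - z) \<le> norm (x - y) + norm (y - z)"
    using norm_triangle_ineq[of "x - y" "y - z"] by simp
  then have "(norm (x - z))\<^sup>2 \<le> (norm (x - y) + norm (y - z))\<^sup>2"
    by (simp add: power_mono)
  also have "\<dots> \<le> 2 * (norm (x - y))\<^sup>2 + 2 * (norm (y - z))\<^sup>2"
    using sum_squares_ge_zero[of "norm (x - y) - norm (y - z)" 0]
    by (simp add: power2_eq_square algebra_simps)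
  also have "(norm (y - z))\<^sup>2 \<le> 1"
    using yz by (simp add: dist_norm power_le_one)
  finally have sq: "(norm (x - z))\<^sup>2 \<le> 2 * (norm (x - y))\<^sup>2 + 2" by simp
  have "- (norm (x - y))\<^sup>2 / (4 * t) \<le> - (norm (x - y))\<^sup>2 / (4 * s)"
    using t by (simp add: frac_le)
  also have "\<dots> \<le> 1 / (4 * s) + - (norm (x - z))\<^sup>2 / (4 * (2 * s))"
    using sq t by (simp add: field_simps)
  finally have e: "exp (- (norm (x - y))\<^sup>2 / (4 * t))
      \<le> exp (1 / (4 * s)) * exp (- (norm (x - z))\<^sup>2 / (4 * (2 * s)))"
    by (simp only: exp_add[symmetric] exp_le_cancel_iff)
  have "(4 * pi * (2 * s)) powr ?d = (2 * s / t) powr ?d * (4 * pi * t) powr ?d"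
    using t by (subst powr_mult[symmetric]) (auto simp: ac_simps)
  moreover have "(4 * pi * t) powr ?d > 0" "(2 * s / t) powr ?d > 0" using t by auto
  ultimately show ?thesis
    using e by (simp add: heat_kernel_def divide_right_mono)
qed

text \<open>
  This turns the Gaussian integrability that defines \<open>M_0\<close> into integrability of the kernel centred
  at any point: \<open>|y|\<^sup>2 \<le> 2|x - y|\<^sup>2 + 2|x|\<^sup>2\<close>.
\<close>

lemma heat_kernel_le_centered:
  fixes x y :: "'a::euclidean_space"
  assumes "0 < t"
  shows "heat_kernel t (x - y)
    \<le> exp ((norm x)\<^sup>2 / (4 * t)) / (4 * pi * t) powr (real DIM('a) / 2) * exp (- (1 / (8 * t)) * (norm y)\<^sup>2)"
proof -
  have "norm y \<le> norm (x - y) + norm x"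
    using norm_triangle_ineq[of "y - x" x] by (simp add: norm_minus_commute)
  then have "(norm y)\<^sup>2 \<le> (norm (x - y) + norm x)\<^sup>2" 
    by (simp add: power_mono)
  also have "\<dots> \<le> 2 * (norm (x - y))\<^sup>2 + 2 * (norm x)\<^sup>2"
    using sum_squares_ge_zero[of "norm (x - y) - norm x" 0]
    by (simp add: power2_eq_square algebra_simps)
  finally have "- (norm (x - y))\<^sup>2 / (4 * t) \<le> (norm x)\<^sup>2 / (4 * t) + - (1 / (8 * t)) * (norm y)\<^sup>2"
    using assms by (simp add: field_simps)
  then have "exp (- (norm (x - y))\<^sup>2 / (4 * t))
      \<le> exp ((norm x)\<^sup>2 / (4 * t)) * exp (- (1 / (8 * t)) * (norm y)\<^sup>2)"
    by (simp only: exp_add[symmetric] exp_le_cancel_iff)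
  then show ?thesis
    by (simp add: heat_kernel_def divide_right_mono)
qed

section \<open>Potentials of measures bounded on unit balls\<close>

lemma sigma_finite_radon_measure:
  assumes "radon_measure (M :: 'a::euclidean_space measure)"
  shows "sigma_finite_measure M"
proof
  let ?A = "range (\<lambda>n::nat. cball (0::'a) (real n))"
  have "\<Union>?A = UNIV"
    using real_arch_simple by (auto simp: dist_norm)
  moreover have "space M = UNIV"
    using assms sets_eq_imp_space_eq[of M borel] by (simp add: radon_measure_def)
  moreover have "emeasure M (cball 0 (real n)) \<noteq> \<infinity>" for n
    using assms compact_cball[of "0::'a" "real n"] by (metis radon_measure_def less_irrefl)
  ultimately show "\<exists>A. countable A \<and> A \<subseteq> sets M \<and> \<Union>A = space M \<and> (\<forall>a\<in>A. emeasure M a \<noteq> \<infinity>)"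
    using assms by (intro exI[of _ ?A]) (auto simp: radon_measure_def simp del: infinity_ennreal_def)
qed

text \<open>
  Multiplying \<open>g(y)\<close> by the volume of \<open>B(y,1)\<close> writes it as an integral over that ball, where
  \<open>h\<close> dominates \<open>g(y)\<close>; after exchanging the integrals, \<open>h(z)\<close> is weighted by the \<open>M\<close>-mass of
  \<open>B(z,1)\<close>.
\<close>

lemma nn_integral_le_of_unit_ball_bound:
  fixes M :: "'a::euclidean_space measure"
  assumes M: "radon_measure M" and N: "\<And>x. emeasure M (ball x 1) \<le> N"
    and [measurable]: "g \<in> borel_measurable borel" "h \<in> borel_measurable borel"
    and gh: "\<And>y z. dist y z < 1 \<Longrightarrow> g y \<le> (h z :: ennreal)"
  shows "ennreal (unit_ball_vol (real DIM('a))) * (\<integral>\<^sup>+y. g y \<partial>M) \<le> N * (\<integral>\<^sup>+z. h z \<partial>lborel)"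
proof -
  interpret sigma_finite_measure M by (rule sigma_finite_radon_measure[OF M])
  have sM [measurable_cong]: "sets M = sets borel" using M by (simp add: radon_measure_def)
  interpret pair_sigma_finite M lborel ..
  have "ennreal (unit_ball_vol (real DIM('a))) * (\<integral>\<^sup>+y. g y \<partial>M)
      = (\<integral>\<^sup>+y. g y * emeasure lborel (ball y 1) \<partial>M)"
    by (simp add: emeasure_ball nn_integral_multc mult.commute)
  also have "\<dots> = (\<integral>\<^sup>+y. (\<integral>\<^sup>+z. g y * indicator (ball y 1) z \<partial>lborel) \<partial>M)"
    by (simp add: nn_integral_cmult_indicator)
  also have "\<dots> \<le> (\<integral>\<^sup>+y. (\<integral>\<^sup>+z. (if dist y z < 1 then h z else 0) \<partial>lborel) \<partial>M)"
    by (intro nn_integral_mono) (auto simp: gh split: split_indicator)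
  also have "\<dots> = (\<integral>\<^sup>+z. (\<integral>\<^sup>+y. (if dist y z < 1 then h z else 0) \<partial>M) \<partial>lborel)"
    by (rule Fubini'[symmetric]) measurable
  also have "\<dots> = (\<integral>\<^sup>+z. (\<integral>\<^sup>+y. h z * indicator (ball z 1) y \<partial>M) \<partial>lborel)"
    by (intro nn_integral_cong) (auto simp: dist_commute split: split_indicator)
  also have "\<dots> = (\<integral>\<^sup>+z. h z * emeasure M (ball z 1) \<partial>lborel)"
    by (simp add: nn_integral_cmult_indicator sM)
  also have "\<dots> \<le> (\<integral>\<^sup>+z. h z * N \<partial>lborel)"
    by (intro nn_integral_mono mult_left_mono N) auto
  also have "\<dots> = N * (\<integral>\<^sup>+z. h z \<partial>lborel)"
    by (simp add: nn_integral_multc mult.commute[of N])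
  finally show ?thesis .
qed

lemma heat_potential_le:
  fixes M :: "'a::euclidean_space measure"
  assumes M: "radon_measure M" and N: "\<And>x. emeasure M (ball x 1) \<le> N" and t: "0 < t" "t \<le> s"
  shows "(\<integral>\<^sup>+y. ennreal (heat_kernel t (x - y)) \<partial>M)
    \<le> ennreal (exp (1 / (4 * s)) * (2 * s / t) powr (real DIM('a) / 2)
        / unit_ball_vol (real DIM('a))) * N"
proof -
  let ?\<omega> = "unit_ball_vol (real DIM('a))"
  let ?c = "exp (1 / (4 * s)) * (2 * s / t) powr (real DIM('a) / 2)"
  let ?I = "\<integral>\<^sup>+y. ennreal (heat_kernel t (x - y)) \<partial>M"
  have \<omega>: "?\<omega> > 0" by (rule unit_ball_vol_pos) simp
  have "(\<integral>\<^sup>+z. ennreal (heat_kernel (2 * s) (x - z)) \<partial>lborel)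
      = (\<integral>\<^sup>+z. ennreal (heat_kernel (2 * s) (z - x)) \<partial>lborel)"
    by (simp add: heat_kernel_def norm_minus_commute)
  also have "\<dots> = (\<integral>\<^sup>+z. ennreal (heat_kernel (2 * s) (z - x)) \<partial>distr lborel borel ((+) x))"
    by (simp add: lborel_distr_plus)
  also have "\<dots> = (\<integral>\<^sup>+z. ennreal (heat_kernel (2 * s) z) \<partial>(lborel :: 'a measure))"
    by (subst nn_integral_distr) auto
  also have "\<dots> = 1"
    using t by (intro nn_integral_heat_kernel) auto
  finally have K: "(\<integral>\<^sup>+z. ennreal (heat_kernel (2 * s) (x - z)) \<partial>lborel) = 1" .
  \<comment> \<open>the kernel at time \<open>2s\<close> dominates in the averaging lemma and has integral \<open>1\<close>\<close>
  have "ennreal ?\<omega> * ?I \<le> N * (\<integral>\<^sup>+z. ennreal (?c * heat_kernel (2 * s) (x - z)) \<partial>lborel)"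
    using t by (intro nn_integral_le_of_unit_ball_bound M N ennreal_leI heat_kernel_le_of_dist_less_1) auto
  also have "\<dots> = ennreal ?c * N"
    using K by (simp add: ennreal_mult'[of ?c] nn_integral_cmult mult.commute[of N] del: exp_gt_zero)
  finally have *: "ennreal ?\<omega> * ?I \<le> ennreal ?c * N" .
  have "?I = ennreal (1 / ?\<omega>) * (ennreal ?\<omega> * ?I)"
    using \<omega> by (simp add: mult.assoc[symmetric] ennreal_mult'[symmetric] less_imp_neq[THEN not_sym])
  also have "\<dots> \<le> ennreal (1 / ?\<omega>) * (ennreal ?c * N)"
    by (intro mult_left_mono *) auto
  also have "\<dots> = ennreal (?c / ?\<omega>) * N"
    using \<omega> by (simp add: mult.assoc[symmetric] ennreal_mult'[symmetric])
  finally show ?thesis .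
qed

text \<open>
  Substituting \<open>x = y + w\<close> makes the inner \<open>y\<close>-integral the mass of the shifted ball \<open>B(a - w, 1)\<close>,
  which is at most \<open>N\<close>, and the remaining weight is a probability density.
\<close>

lemma nn_integral_ball_heat_potential_le:
  fixes M :: "'a::euclidean_space measure"
  assumes M: "radon_measure M" and N: "\<And>x. emeasure M (ball x 1) \<le> N" and t: "0 < t"
  shows "(\<integral>\<^sup>+x. (\<integral>\<^sup>+y. ennreal (heat_kernel t (x - y)) \<partial>M) * indicator (ball a 1) x \<partial>lborel) \<le> N"
proof -
  interpret sigma_finite_measure M by (rule sigma_finite_radon_measure[OF M])
  have sM [measurable_cong]: "sets M = sets borel" using M by (simp add: radon_measure_def)
  have [measurable]: "ball a 1 \<in> sets borel" by simp
  interpret pair_sigma_finite M lborel ..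
  have "(\<integral>\<^sup>+x. (\<integral>\<^sup>+y. ennreal (heat_kernel t (x - y)) \<partial>M) * indicator (ball a 1) x \<partial>lborel)
      = (\<integral>\<^sup>+x. (\<integral>\<^sup>+y. ennreal (heat_kernel t (x - y)) * indicator (ball a 1) x \<partial>M) \<partial>lborel)"
    by (simp add: nn_integral_multc)
  also have "\<dots> = (\<integral>\<^sup>+y. (\<integral>\<^sup>+x. ennreal (heat_kernel t (x - y)) * indicator (ball a 1) x \<partial>lborel) \<partial>M)"
    by (rule Fubini') measurable
  also have "\<dots> = (\<integral>\<^sup>+y. (\<integral>\<^sup>+x. ennreal (heat_kernel t (x - y)) * indicator (ball a 1) x
      \<partial>distr lborel borel ((+) y)) \<partial>M)"
    by (simp add: lborel_distr_plus)
  also have "\<dots> = (\<integral>\<^sup>+y. (\<integral>\<^sup>+w. ennreal (heat_kernel t w) * indicator (ball a 1) (y + w) \<partial>lborel) \<partial>M)"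
    by (subst nn_integral_distr) auto
  also have "\<dots> = (\<integral>\<^sup>+w. (\<integral>\<^sup>+y. ennreal (heat_kernel t w) * indicator (ball a 1) (y + w) \<partial>M) \<partial>lborel)"
    by (rule Fubini'[symmetric]) measurable
  also have "\<dots> = (\<integral>\<^sup>+w. (\<integral>\<^sup>+y. ennreal (heat_kernel t w) * indicator (ball (a - w) 1) y \<partial>M) \<partial>lborel)"
    by (intro nn_integral_cong) (auto simp: dist_norm algebra_simps split: split_indicator)
  also have "\<dots> = (\<integral>\<^sup>+w. ennreal (heat_kernel t w) * emeasure M (ball (a - w) 1) \<partial>lborel)"
    by (simp add: nn_integral_cmult_indicator sM)
  also have "\<dots> \<le> (\<integral>\<^sup>+w. ennreal (heat_kernel t (w::'a)) * N \<partial>lborel)"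
    by (intro nn_integral_mono mult_left_mono N) auto
  also have "\<dots> = N"
    using t by (simp add: nn_integral_multc nn_integral_heat_kernel)
  finally show ?thesis .
qed

section \<open>Lebesgue norms of bounded functions\<close>

text \<open>Both summands of \<open>1 = T/(T+1) + 1/(T+1)\<close> lie in \<open>[0,1]\<close> and so increase under the power
  \<open>\<theta> \<le> 1\<close>.\<close>

lemma powr_add_one_le:
  fixes T \<theta> :: real
  assumes "0 \<le> T" "0 \<le> \<theta>" "\<theta> \<le> 1"
  shows "(T + 1) powr \<theta> \<le> T powr \<theta> + 1"
proof -
  have *: "a \<le> a powr \<theta>" if "0 \<le> a" "a \<le> 1" for a :: real
    using powr_mono'[of \<theta> 1 a] that assms by auto
  have "1 = T / (T + 1) + 1 / (T + 1)"
    using assms by (simp add: field_simps)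
  also have "\<dots> \<le> (T / (T + 1)) powr \<theta> + (1 / (T + 1)) powr \<theta>"
    using assms by (intro add_mono *) auto
  also have "\<dots> = (T powr \<theta> + 1) / (T + 1) powr \<theta>"
    using assms by (simp add: powr_divide add_divide_distrib)
  finally show ?thesis
    using assms by (simp add: field_simps)
qed

lemma Lq_norm_infinity_le:
  assumes "f \<in> borel_measurable (lebesgue_on A)" "\<And>x. \<bar>f x\<bar> \<le> B"
  shows "Lq_norm \<infinity> A f \<le> ennreal B"
  using assms by (auto simp: Lq_norm_def intro!: esssup_I ennreal_leI)

text \<open>Interpolation between \<open>L\<^sup>1\<close> and \<open>L\<^sup>\<infinity>\<close>: pointwise \<open>|f|\<^sup>r \<le> B\<^bsup>r-1\<^esup> |f|\<close>.\<close>

lemma Lq_norm_finite_le: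
  fixes f :: "'a::euclidean_space \<Rightarrow> real"
  assumes f: "f \<in> borel_measurable (lebesgue_on A)" and q: "1 \<le> q" "q < \<infinity>"
    and B: "\<And>x. \<bar>f x\<bar> \<le> B" and J: "(\<integral>\<^sup>+x. ennreal \<bar>f x\<bar> \<partial>lebesgue_on A) \<le> ennreal J" and "0 \<le> J"
  shows "Lq_norm q A f
    \<le> ennreal (B powr (1 - enn2real (1 / q)) * J powr enn2real (1 / q))"
proof -
  obtain r where r: "q = ennreal r" "1 \<le> r"
    using q by (cases q) (auto simp: ennreal_1[symmetric] simp del: ennreal_1)
  have qr: "enn2real q = r" "enn2real (1 / q) = 1 / r"
    using r by (auto simp: ennreal_1[symmetric] divide_ennreal simp del: ennreal_1)
  have B0: "0 \<le> B" using B[of undefined] by linarith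
  define I where "I = (\<integral>\<^sup>+x. ennreal (\<bar>f x\<bar> powr r) \<partial>lebesgue_on A)"
  have "\<bar>f x\<bar> powr r \<le> B powr (r - 1) * \<bar>f x\<bar>" for x
  proof (cases "f x = 0")
    case False
    have "\<bar>f x\<bar> powr r = \<bar>f x\<bar> powr (r - 1) * \<bar>f x\<bar>"
      using False powr_add[of "\<bar>f x\<bar>" "r - 1" 1] by simp
    also have "\<dots> \<le> B powr (r - 1) * \<bar>f x\<bar>"
      using r B by (intro mult_right_mono powr_mono2) auto
    finally show ?thesis .
  qed (use r in simp)
  then have "I \<le> (\<integral>\<^sup>+x. ennreal (B powr (r - 1)) * ennreal \<bar>f x\<bar> \<partial>lebesgue_on A)"
    unfolding I_def by (intro nn_integral_mono) (simp add: ennreal_mult'[symmetric] ennreal_leI)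
  also have "\<dots> = ennreal (B powr (r - 1)) * (\<integral>\<^sup>+x. ennreal \<bar>f x\<bar> \<partial>lebesgue_on A)"
    using f by (intro nn_integral_cmult) auto
  also have "\<dots> \<le> ennreal (B powr (r - 1)) * ennreal J"
    by (intro mult_left_mono J) auto
  also have "\<dots> = ennreal (B powr (r - 1) * J)"
    using \<open>0 \<le> J\<close> by (simp add: ennreal_mult')
  finally have I: "I \<le> ennreal (B powr (r - 1) * J)" .
  then have fin: "I \<noteq> \<infinity>" by (auto simp: top_unique)
  have "enn2real I \<le> B powr (r - 1) * J"
    using I \<open>0 \<le> J\<close> by (simp add: enn2real_leI)
  then have "enn2real I powr (1 / r) \<le> (B powr (r - 1) * J) powr (1 / r)"
    using r by (intro powr_mono2) auto
  also have "\<dots> = B powr (1 - 1 / r) * J powr (1 / r)"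
    using B0 \<open>0 \<le> J\<close> r by (simp add: powr_mult powr_powr diff_divide_distrib)
  finally show ?thesis
    using fin less_imp_neq[OF q(2)] qr
    by (simp add: Lq_norm_def I_def[symmetric] Let_def ennreal_leI)
qed

lemma bounded_in_Lq_loc:
  assumes f: "f \<in> borel_measurable borel" and B: "\<And>x. \<bar>f x\<bar> \<le> B" and q: "1 \<le> q"
  shows "f \<in> Lq_loc q"
proof -
  have "f \<in> Lq q K" if K: "compact K" for K
  proof -
    have m: "f \<in> borel_measurable (lebesgue_on K)"
      using f by (simp add: measurable_restrict_space1 measurable_completion)
    have "Lq_norm q K f < \<infinity>"
    proof (cases "q = \<infinity>")
      case True
      then show ?thesis
        using Lq_norm_infinity_le[OF m B] by (auto simp: less_top[symmetric] top_unique)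
    next
      case False
      have KB: "K \<in> sets borel" using K by (simp add: borel_compact)
      have "(\<integral>\<^sup>+x. ennreal \<bar>f x\<bar> \<partial>lebesgue_on K) \<le> (\<integral>\<^sup>+x. ennreal B \<partial>lebesgue_on K)"
        by (intro nn_integral_mono ennreal_leI B)
      also have "\<dots> = ennreal B * emeasure lborel K"
        using KB by (simp add: emeasure_restrict_space space_restrict_space)
      also have "\<dots> < \<infinity>"
        using emeasure_compact_finite[OF K] by (simp add: ennreal_mult_less_top)
      finally obtain J where "0 \<le> J" "(\<integral>\<^sup>+x. ennreal \<bar>f x\<bar> \<partial>lebesgue_on K) = ennreal J"
        by (cases "\<integral>\<^sup>+x. ennreal \<bar>f x\<bar> \<partial>lebesgue_on K") auto
      then show ?thesis
        using Lq_norm_finite_le[OF m q _ B, of J] False by (auto simp: less_top[symmetric] top_unique)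
    qed
    with m show ?thesis by (simp add: Lq_def)
  qed
  then show ?thesis by (simp add: Lq_loc_def)
qed

section \<open>The heat flow of a uniform measure\<close>

lemma radon_measure_total_variation:
  assumes "\<mu> \<in> M_loc"
  shows "radon_measure (total_variation \<mu>)"
  using assms by (auto simp: radon_measure_def sets_total_variation emeasure_total_variation borel_compact M_loc_def)

lemma emeasure_ball_le_M_U_norm: "emeasure (total_variation \<mu>) (ball x 1) \<le> M_U_norm \<mu>"
  unfolding M_U_norm_def by (rule SUP_upper) simp

lemma nn_integral_parts_le_total_variation:
  assumes "\<mu> \<in> M_loc"
  shows "(\<integral>\<^sup>+x. f x \<partial>pos_part \<mu>) \<le> (\<integral>\<^sup>+x. f x \<partial>total_variation \<mu>)"
    and "(\<integral>\<^sup>+x. f x \<partial>neg_part \<mu>) \<le> (\<integral>\<^sup>+x. f x \<partial>total_variation \<mu>)"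
proof -
  have s: "sets (pos_part \<mu>) = sets borel" "sets (neg_part \<mu>) = sets borel"
    using assms by (auto simp: M_loc_def radon_measure_def)
  have "pos_part \<mu> \<le> total_variation \<mu>" "neg_part \<mu> \<le> total_variation \<mu>"
    using s sets_total_variation[of \<mu>] assms
    by (auto intro!: le_measure[THEN iffD2] le_funI simp: emeasure_total_variation)
  then show "(\<integral>\<^sup>+x. f x \<partial>pos_part \<mu>) \<le> (\<integral>\<^sup>+x. f x \<partial>total_variation \<mu>)"
    "(\<integral>\<^sup>+x. f x \<partial>neg_part \<mu>) \<le> (\<integral>\<^sup>+x. f x \<partial>total_variation \<mu>)"
    using s by (auto intro!: nn_integral_mono_measure simp: sets_total_variation)
qed

text \<open>
  The flow is a difference of two nonnegative numbers, so its absolute value is at most the larger of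
  them. A divergent Bochner integral has value \<open>0\<close>, which respects the bound.
\<close>

lemma abs_heat_flow_le:
  assumes "\<mu> \<in> M_loc"
  shows "ennreal \<bar>heat_flow \<mu> t x\<bar> \<le> (\<integral>\<^sup>+y. ennreal (heat_kernel t (x - y)) \<partial>total_variation \<mu>)"
proof -
  let ?k = "\<lambda>y. heat_kernel t (x - y)"
  have [measurable_cong]: "sets (pos_part \<mu>) = sets borel" "sets (neg_part \<mu>) = sets borel"
    using assms by (auto simp: M_loc_def radon_measure_def)
  have le: "ennreal (\<integral>y. ?k y \<partial>M) \<le> (\<integral>\<^sup>+y. ennreal (?k y) \<partial>M)"
    if [measurable_cong]: "sets M = sets borel" for M
    by (subst integral_eq_nn_integral) (auto simp: ennreal_enn2real_if)
  have nn: "0 \<le> (\<integral>y. ?k y \<partial>M)" for M by (simp add: integral_nonneg_AE)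
  have "\<bar>heat_flow \<mu> t x\<bar> \<le> max (\<integral>y. ?k y \<partial>pos_part \<mu>) (\<integral>y. ?k y \<partial>neg_part \<mu>)"
    using nn[of "pos_part \<mu>"] nn[of "neg_part \<mu>"] unfolding heat_flow_eq_heat_kernel by linarith
  then have "ennreal \<bar>heat_flow \<mu> t x\<bar> \<le> max (ennreal (\<integral>y. ?k y \<partial>pos_part \<mu>)) (ennreal (\<integral>y. ?k y \<partial>neg_part \<mu>))"
    using nn by (auto simp: max_def ennreal_leI split: if_splits)
  also have "\<dots> \<le> (\<integral>\<^sup>+y. ennreal (?k y) \<partial>total_variation \<mu>)"
    using le[of "pos_part \<mu>"] le[of "neg_part \<mu>"] nn_integral_parts_le_total_variation[OF assms, of "\<lambda>y. ennreal (?k y)"]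
      \<open>sets (pos_part \<mu>) = sets borel\<close> \<open>sets (neg_part \<mu>) = sets borel\<close>
    by (auto intro: order_trans)
  finally show ?thesis .
qed

lemma borel_measurable_heat_flow:
  fixes \<mu> :: "'a::euclidean_space signed_measure"
  assumes "\<mu> \<in> M_loc"
  shows "heat_flow \<mu> t \<in> borel_measurable borel"
proof -
  have m: "(\<lambda>x. \<integral>y. heat_kernel t (x - y) \<partial>M) \<in> borel_measurable borel"
    if M: "radon_measure M" for M :: "'a measure"
  proof -
    interpret sigma_finite_measure M by (rule sigma_finite_radon_measure[OF M])
    have [measurable_cong]: "sets M = sets borel" using M by (simp add: radon_measure_def)
    show ?thesis by measurable
  qed
  show ?thesis
    unfolding heat_flow_eq_heat_kernel[abs_def]
    using assms by (intro borel_measurable_diff m) (auto simp: M_loc_def)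
qed

text \<open>
  For \<open>t \<le> 1\<close> the comparison time is \<open>1\<close>, which produces the singular factor \<open>t\<^bsup>-d/2\<^esup>\<close>; for \<open>t \<ge> 1\<close>
  it is \<open>t\<close> itself, and the bound does not grow.
\<close>

lemma abs_heat_flow_le_uniform:
  fixes \<mu> :: "'a::euclidean_space signed_measure"
  assumes \<mu>: "\<mu> \<in> M_U" and t: "0 < t"
  shows "\<bar>heat_flow \<mu> t x\<bar> \<le> exp (1 / 4) * 2 powr (real DIM('a) / 2) / unit_ball_vol (real DIM('a))
    * (t powr (- (real DIM('a) / 2)) + 1) * enn2real (M_U_norm \<mu>)"
proof -
  let ?d = "real DIM('a) / 2" and ?\<omega> = "unit_ball_vol (real DIM('a))"
  have loc: "\<mu> \<in> M_loc" and fin: "M_U_norm \<mu> < \<infinity>" using \<mu> by (auto simp: M_U_def)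
  define s where "s = max t 1"
  have s: "t \<le> s" "1 \<le> s" by (auto simp: s_def)
  have \<omega>: "?\<omega> > 0" by (rule unit_ball_vol_pos) simp
  have "(s / t) powr ?d \<le> t powr (- ?d) + 1"
    using t by (cases "t \<le> 1") (auto simp: s_def max_def powr_divide powr_minus_divide)
  moreover have "(2 * s / t) powr ?d = 2 powr ?d * (s / t) powr ?d"
    using s t by (subst powr_mult[symmetric]) auto
  ultimately have "(2 * s / t) powr ?d \<le> 2 powr ?d * (t powr (- ?d) + 1)"
    by simp
  moreover have "exp (1 / (4 * s)) \<le> exp (1 / 4)" using s by (simp add: field_simps)
  ultimately have "exp (1 / (4 * s)) * (2 * s / t) powr ?d \<le> exp (1 / 4) * (2 powr ?d * (t powr (- ?d) + 1))"
    by (intro mult_mono) auto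
  then have c: "exp (1 / (4 * s)) * (2 * s / t) powr ?d / ?\<omega>
      \<le> exp (1 / 4) * 2 powr ?d / ?\<omega> * (t powr (- ?d) + 1)"
    using divide_right_mono[OF _ less_imp_le[OF \<omega>]] by (simp add: mult.assoc)
  have "ennreal \<bar>heat_flow \<mu> t x\<bar> \<le> (\<integral>\<^sup>+y. ennreal (heat_kernel t (x - y)) \<partial>total_variation \<mu>)"
    by (rule abs_heat_flow_le[OF loc])
  also have "\<dots> \<le> ennreal (exp (1 / (4 * s)) * (2 * s / t) powr ?d / ?\<omega>) * M_U_norm \<mu>"
    using s t by (intro heat_potential_le radon_measure_total_variation loc emeasure_ball_le_M_U_norm)
  also have "\<dots> \<le> ennreal (exp (1 / 4) * 2 powr ?d / ?\<omega> * (t powr (- ?d) + 1)) * M_U_norm \<mu>"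
    by (intro mult_right_mono ennreal_leI c) auto
  also have "\<dots> = ennreal (exp (1 / 4) * 2 powr ?d / ?\<omega> * (t powr (- ?d) + 1) * enn2real (M_U_norm \<mu>))"
    using fin by (subst ennreal_mult''[of "enn2real _"]) (simp_all add: less_top)
  finally show ?thesis
    using \<omega> by (subst (asm) ennreal_le_iff) auto
qed

lemma M_U_subset_M_0: "(M_U :: 'a::euclidean_space signed_measure set) \<subseteq> M_0"
proof
  fix \<mu> :: "'a signed_measure" assume \<mu>: "\<mu> \<in> M_U"
  then have loc: "\<mu> \<in> M_loc" and fin: "M_U_norm \<mu> < \<infinity>" by (auto simp: M_U_def)
  show "\<mu> \<in> M_0"
    unfolding M_0_def M_eps_def
  proof (intro INT_I CollectI conjI loc)
    fix \<epsilon> :: real assume "\<epsilon> \<in> {0<..}"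
    then have \<epsilon>: "0 < \<epsilon>" by simp
    define t where "t = 1 / (4 * \<epsilon>)"
    have t: "0 < t" using \<epsilon> by (simp add: t_def)
    let ?c = "(4 * pi * t) powr (real DIM('a) / 2)"
    have "exp (- \<epsilon> * (norm y)\<^sup>2) = ?c * heat_kernel t (0 - y)" for y :: 'a
      using \<epsilon> t by (simp add: heat_kernel_def t_def)
    then have "(\<integral>\<^sup>+y. ennreal (exp (- \<epsilon> * (norm y)\<^sup>2)) \<partial>total_variation \<mu>)
        = (\<integral>\<^sup>+y. ennreal ?c * ennreal (heat_kernel t (0 - y)) \<partial>total_variation \<mu>)"
      by (simp add: ennreal_mult')
    also have "\<dots> = ennreal ?c * (\<integral>\<^sup>+y. ennreal (heat_kernel t (0 - y)) \<partial>total_variation \<mu>)"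
      by (intro nn_integral_cmult) (simp add: measurable_cong_sets[OF sets_total_variation refl])
    also have "\<dots> < \<infinity>"
    proof -
      have "(\<integral>\<^sup>+y. ennreal (heat_kernel t (0 - y)) \<partial>total_variation \<mu>)
          \<le> ennreal (exp (1 / (4 * t)) * (2 * t / t) powr (real DIM('a) / 2)
              / unit_ball_vol (real DIM('a))) * M_U_norm \<mu>"
        using t by (intro heat_potential_le radon_measure_total_variation loc emeasure_ball_le_M_U_norm) auto
      also have "\<dots> < \<infinity>" using fin by (simp add: ennreal_mult_less_top)
      finally show ?thesis by (simp add: ennreal_mult_less_top)
    qed
    finally show "(\<integral>\<^sup>+y. ennreal (exp (- \<epsilon> * (norm y)\<^sup>2)) \<partial>total_variation \<mu>) < \<infinity>" .
  qed
qed

lemma heat_flow_in_L_infinity: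
  assumes "\<mu> \<in> M_U" "0 < t"
  shows "heat_flow \<mu> t \<in> Lq \<infinity> UNIV"
proof -
  have m: "heat_flow \<mu> t \<in> borel_measurable (lebesgue_on UNIV)"
    using assms borel_measurable_heat_flow[of \<mu> t]
    by (simp add: M_U_def measurable_restrict_space1 measurable_completion)
  show ?thesis
    using Lq_norm_infinity_le[OF m abs_heat_flow_le_uniform[OF assms]] m
    by (auto simp: Lq_def less_top[symmetric] top_unique)
qed

lemma nn_integral_ball_heat_flow_le:
  fixes \<mu> :: "'a::euclidean_space signed_measure"
  assumes loc: "\<mu> \<in> M_loc" and t: "0 < t"
  shows "(\<integral>\<^sup>+x. ennreal \<bar>heat_flow \<mu> t x\<bar> \<partial>lebesgue_on (ball a 1)) \<le> M_U_norm \<mu>"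
proof -
  have "(\<integral>\<^sup>+x. ennreal \<bar>heat_flow \<mu> t x\<bar> \<partial>lebesgue_on (ball a 1))
      = (\<integral>\<^sup>+x. ennreal \<bar>heat_flow \<mu> t x\<bar> * indicator (ball a 1) x \<partial>lborel)"
    by (simp add: nn_integral_restrict_space nn_integral_completion)
  also have "\<dots> \<le> (\<integral>\<^sup>+x. (\<integral>\<^sup>+y. ennreal (heat_kernel t (x - y)) \<partial>total_variation \<mu>)
      * indicator (ball a 1) x \<partial>lborel)"
    by (intro nn_integral_mono mult_right_mono abs_heat_flow_le loc) auto
  also have "\<dots> \<le> M_U_norm \<mu>"
    by (intro nn_integral_ball_heat_potential_le radon_measure_total_variation loc
        emeasure_ball_le_M_U_norm t)
  finally show ?thesis .
qed

text \<open>
  With \<open>\<theta> = 1 - 1/q\<close>, interpolation gives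
  \<open>(C (T + 1) n)\<^sup>\<theta> n\<^bsup>1-\<theta>\<^esup>\<close> for \<open>T = t\<^bsup>-d/2\<^esup>\<close> and \<open>n = \<parallel>\<mu>\<parallel>\<close>, which is at most
  \<open>C (T\<^sup>\<theta> + 1) n\<close>. Taking \<open>C \<ge> 1\<close> makes \<open>C\<^sup>\<theta> \<le> C\<close>, so that one constant serves all \<open>q\<close>.
\<close>

lemma Lq_U_norm_heat_flow_le:
  fixes \<mu> :: "'a::euclidean_space signed_measure"
  assumes \<mu>: "\<mu> \<in> M_U" and t: "0 < t" and q: "1 \<le> q"
  defines "C \<equiv> max 1 (exp (1 / 4) * 2 powr (real DIM('a) / 2) / unit_ball_vol (real DIM('a)))"
  shows "Lq_U_norm q (heat_flow \<mu> t)
    \<le> ennreal (C * (t powr (- (real DIM('a) / 2) * (1 - enn2real (1 / q))) + 1)) * M_U_norm \<mu>"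
proof -
  let ?u = "heat_flow \<mu> t" and ?d = "real DIM('a) / 2"
  have loc: "\<mu> \<in> M_loc" and fin: "M_U_norm \<mu> < \<infinity>" using \<mu> by (auto simp: M_U_def)
  define n where "n = enn2real (M_U_norm \<mu>)"
  have n: "0 \<le> n" "M_U_norm \<mu> = ennreal n" using fin by (auto simp: n_def less_top)
  define T where "T = t powr (- ?d)"
  have T: "0 \<le> T" by (simp add: T_def)
  have C: "1 \<le> C" by (simp add: C_def)
  let ?B = "C * (T + 1) * n"
  have B: "\<bar>?u x\<bar> \<le> ?B" for x
  proof -
    have "\<bar>?u x\<bar> \<le> exp (1 / 4) * 2 powr ?d / unit_ball_vol (real DIM('a)) * (T + 1) * n"
      unfolding T_def n_def by (rule abs_heat_flow_le_uniform[OF \<mu> t])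
    also have "\<dots> \<le> ?B"
      using n T by (intro mult_right_mono) (auto simp: C_def)
    finally show ?thesis .
  qed
  define \<theta> where "\<theta> = 1 - enn2real (1 / q)"
  have "enn2real (1 / q) \<le> 1"
  proof (cases q)
    case (real r)
    then have "1 \<le> r" using q by (simp add: ennreal_1[symmetric] del: ennreal_1)
    then have "1 / q = ennreal (1 / r)"
      using real divide_ennreal[of 1 r] by simp
    then show ?thesis using \<open>1 \<le> r\<close> by simp
  qed simp
  then have \<theta>: "0 \<le> \<theta>" "\<theta> \<le> 1" by (auto simp: \<theta>_def)
  have goal: "ennreal (C * (t powr (- ?d * \<theta>) + 1)) * M_U_norm \<mu> = ennreal (C * (T powr \<theta> + 1) * n)"
    using n by (simp add: T_def powr_powr ennreal_mult'')
  have "Lq_norm q (ball a 1) ?u \<le> ennreal (C * (T powr \<theta> + 1) * n)" for a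
  proof (cases "q = \<infinity>")
    case True
    have m: "?u \<in> borel_measurable (lebesgue_on (ball a 1))"
      using borel_measurable_heat_flow[OF loc]
      by (simp add: measurable_restrict_space1 measurable_completion)
    show ?thesis
      using Lq_norm_infinity_le[OF m B] True T by (simp add: \<theta>_def)
  next
    case False
    have m: "?u \<in> borel_measurable (lebesgue_on (ball a 1))"
      using borel_measurable_heat_flow[OF loc]
      by (simp add: measurable_restrict_space1 measurable_completion)
    have "Lq_norm q (ball a 1) ?u \<le> ennreal (?B powr (1 - enn2real (1 / q)) * n powr enn2real (1 / q))"
      using False q n nn_integral_ball_heat_flow_le[OF loc t, of a]
      by (intro Lq_norm_finite_le m B) (auto simp: less_top)
    also have "?B powr (1 - enn2real (1 / q)) * n powr enn2real (1 / q)
        = C powr \<theta> * (T + 1) powr \<theta> * (n powr \<theta> * n powr (1 - \<theta>))"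
      using n T C by (simp add: powr_mult \<theta>_def)
    also have "n powr \<theta> * n powr (1 - \<theta>) = n"
      using n by (simp add: powr_add[symmetric])
    also have "C powr \<theta> * (T + 1) powr \<theta> * n \<le> C * (T powr \<theta> + 1) * n"
      using n T C \<theta> powr_mono[of \<theta> 1 C]
      by (intro mult_right_mono mult_mono powr_add_one_le) auto
    finally show ?thesis by (simp add: ennreal_leI)
  qed
  then show ?thesis
    unfolding Lq_U_norm_def \<theta>_def[symmetric] goal by (intro SUP_least)
qed

section \<open>Initial measures with bounded heat flow\<close>

text \<open>
  The essential bound holds only almost everywhere, hence at some point \<open>x\<close> of \<open>B(a,1)\<close> rather than
  at the centre. Every \<open>y\<close> in the ball is then within distance \<open>2\<close> of \<open>x\<close>, which is the
  source of the factor \<open>e\<^bsup>-4/(4t)\<^esup>\<close>. Membership in \<open>M_0\<close> guarantees that the integral defining the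
  flow converges, so that it really dominates the mass.
\<close>

lemma M_U_if_heat_flow_bounded:
  fixes \<mu> :: "'a::euclidean_space signed_measure"
  assumes \<mu>: "\<mu> \<in> M_0" and nonneg: "nonneg_measure \<mu>" and t: "0 < t"
    and u: "heat_flow \<mu> t \<in> Lq \<infinity> UNIV"
  shows "\<mu> \<in> M_U"
proof -
  let ?u = "heat_flow \<mu> t" and ?P = "pos_part \<mu>" and ?c = "(4 * pi * t) powr (real DIM('a) / 2)"
  have loc: "\<mu> \<in> M_loc" using \<mu> by (auto simp: M_0_def M_eps_def dest: bspec[of _ _ 1])
  have sP [measurable_cong]: "sets ?P = sets borel" and sN: "sets (neg_part \<mu>) = sets borel"
    using loc by (auto simp: M_loc_def radon_measure_def)
  have "(\<integral>y. heat_kernel t (x - y) \<partial>neg_part \<mu>) = 0" for x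
  proof -
    have "AE y in neg_part \<mu>. heat_kernel t (x - y) = 0"
      using nonneg sN sets_eq_imp_space_eq[OF sN]
      by (intro AE_I[of _ _ UNIV]) (auto simp: nonneg_measure_def)
    then show ?thesis by (rule integral_eq_zero_AE)
  qed
  then have u_eq: "?u x = (\<integral>y. heat_kernel t (x - y) \<partial>?P)" for x
    by (simp add: heat_flow_eq_heat_kernel)
  have int: "integrable ?P (\<lambda>y. heat_kernel t (x - y))" for x
  proof (rule Bochner_Integration.integrable_bound)
    let ?e = "\<lambda>y::'a. exp (- (1 / (8 * t)) * (norm y)\<^sup>2)"
    have "\<mu> \<in> M_eps (1 / (8 * t))"
      using \<mu> t by (simp add: M_0_def)
    then have "(\<integral>\<^sup>+y. ennreal (?e y) \<partial>?P) < \<infinity>"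
      using nn_integral_parts_le_total_variation(1)[OF loc, of "\<lambda>y. ennreal (?e y)"]
      unfolding M_eps_def by (blast intro: order.strict_trans1)
    then have "integrable ?P ?e"
      by (intro integrableI_nonneg) auto
    then show "integrable ?P (\<lambda>y. exp ((norm x)\<^sup>2 / (4 * t)) / ?c * ?e y)"
      by (rule integrable_mult_right)
    show "AE y in ?P. norm (heat_kernel t (x - y)) \<le> norm (exp ((norm x)\<^sup>2 / (4 * t)) / ?c * ?e y)"
      using heat_kernel_le_centered[OF t, of x] by (auto simp: abs_mult)
  qed auto
  obtain B where B: "0 \<le> B" "AE x in lborel. \<bar>?u x\<bar> \<le> B"
  proof -
    have "esssup lebesgue (\<lambda>x. ennreal \<bar>?u x\<bar>) < \<infinity>"
      using u by (simp add: Lq_def Lq_norm_def lebesgue_on_UNIV_eq)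
    then obtain B where B: "0 \<le> B" "esssup lebesgue (\<lambda>x. ennreal \<bar>?u x\<bar>) = ennreal B"
      by (cases "esssup lebesgue (\<lambda>x. ennreal \<bar>?u x\<bar>)") auto
    have "AE x in lebesgue. ennreal \<bar>?u x\<bar> \<le> esssup lebesgue (\<lambda>x. ennreal \<bar>?u x\<bar>)"
      by (rule esssup_AE)
    then have "AE x in lebesgue. \<bar>?u x\<bar> \<le> B"
      using B by simp
    with B that show thesis by (simp add: AE_completion_iff)
  qed
  have "emeasure (total_variation \<mu>) (ball a 1) \<le> ennreal (B * ?c * exp (1 / t))" for a
  proof -
    \<comment> \<open>a ball has positive volume, so it meets the set where the essential bound holds\<close>
    have "\<not> (AE x in lborel. x \<notin> ball a 1)"
      using content_ball_pos[of 1 a] by (subst AE_iff_measurable[OF _ refl]) (auto simp: measure_def ball_def)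
    then obtain x where x: "dist a x < 1" "\<bar>?u x\<bar> \<le> B"
      using B(2) by (metis (mono_tags, lifting) AE_mp AE_I2 mem_ball)
    have "heat_kernel t (x - y) \<ge> indicator (ball a 1) y * (exp (- 1 / t) / ?c)" for y
    proof (cases "y \<in> ball a 1")
      case True
      have "norm (x - y) \<le> 2"
        using x(1) True dist_triangle[of x y a] by (simp add: dist_norm norm_minus_commute)
      then have "(norm (x - y))\<^sup>2 \<le> 2\<^sup>2" by (intro power_mono) auto
      then have "exp (- 1 / t) \<le> exp (- (norm (x - y))\<^sup>2 / (4 * t))"
        using t by (simp add: field_simps)
      then show ?thesis using True by (simp add: heat_kernel_def divide_right_mono)
    qed simp
    moreover have fin: "emeasure ?P (ball a 1) < \<infinity>"
    proof -
      have "emeasure ?P (ball a 1) \<le> emeasure ?P (cball a 1)"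
        using sP by (intro emeasure_mono) auto
      also have "\<dots> < \<infinity>" using loc compact_cball[of a 1] unfolding M_loc_def radon_measure_def by blast
      finally show ?thesis .
    qed
    ultimately have "(\<integral>y. indicator (ball a 1) y * (exp (- 1 / t) / ?c) \<partial>?P)
        \<le> (\<integral>y. heat_kernel t (x - y) \<partial>?P)"
      using sP by (intro integral_mono int) auto
    then have "measure ?P (ball a 1) * (exp (- 1 / t) / ?c) \<le> B"
      using x(2) sP sets_eq_imp_space_eq[OF sP] by (simp add: u_eq)
    then have "measure ?P (ball a 1) \<le> B * ?c * exp (1 / t)"
      using t by (simp add: field_simps exp_minus)
    moreover have "emeasure (total_variation \<mu>) (ball a 1) = ennreal (measure ?P (ball a 1))"
      using nonneg emeasure_eq_ennreal_measure[of ?P "ball a 1"] fin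
      by (simp add: emeasure_total_variation[OF loc] nonneg_measure_def)
    ultimately show ?thesis by (simp add: ennreal_leI)
  qed
  then have "M_U_norm \<mu> \<le> ennreal (B * ?c * exp (1 / t))"
    unfolding M_U_norm_def by (intro SUP_least)
  then show ?thesis
    using loc by (auto simp: M_U_def less_top[symmetric] top_unique)
qed

section \<open>Uniform measures and bounded heat flows\<close>

theorem proposition5p2:
  shows "(\<exists>C::real. \<forall>u\<^sub>0 \<in> (M_U :: 'a::euclidean_space signed_measure set).
            u\<^sub>0 \<in> M_0
          \<and> (\<forall>t>0. heat_flow u\<^sub>0 t \<in> Lq \<infinity> UNIV)
          \<and> (\<forall>q\<ge>1. \<forall>t>0. heat_flow u\<^sub>0 t \<in> Lq_U q
               \<and> Lq_U_norm q (heat_flow u\<^sub>0 t)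
                   \<le> ennreal (C * (t powr (- (real DIM('a) / 2) * (1 - enn2real (1 / q))) + 1))
                      * M_U_norm u\<^sub>0))
       \<and> (\<forall>u\<^sub>0 \<in> (M_0 :: 'a signed_measure set). \<forall>t\<^sub>0>0.
            nonneg_measure u\<^sub>0
            \<longrightarrow> (AE x in lebesgue. 0 \<le> heat_flow u\<^sub>0 t\<^sub>0 x)
            \<longrightarrow> heat_flow u\<^sub>0 t\<^sub>0 \<in> Lq \<infinity> UNIV
            \<longrightarrow> u\<^sub>0 \<in> M_U \<and> (\<forall>t>0. heat_flow u\<^sub>0 t \<in> Lq \<infinity> UNIV))"
proof (intro conjI exI ballI allI impI)
  fix \<mu> :: "'a signed_measure" and t :: real and q :: ennreal
  assume \<mu>: "\<mu> \<in> M_U"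
  then have loc: "\<mu> \<in> M_loc" and fin: "M_U_norm \<mu> < \<infinity>" by (auto simp: M_U_def)
  show "\<mu> \<in> M_0" using \<mu> M_U_subset_M_0 by blast
  assume t: "0 < t"
  show "heat_flow \<mu> t \<in> Lq \<infinity> UNIV" by (rule heat_flow_in_L_infinity[OF \<mu> t])
  assume q: "1 \<le> q"
  note bound = Lq_U_norm_heat_flow_le[OF \<mu> t q]
  then show "Lq_U_norm q (heat_flow \<mu> t)
      \<le> ennreal (max 1 (exp (1 / 4) * 2 powr (real DIM('a) / 2) / unit_ball_vol (real DIM('a)))
          * (t powr (- (real DIM('a) / 2) * (1 - enn2real (1 / q))) + 1)) * M_U_norm \<mu>" .
  have "Lq_U_norm q (heat_flow \<mu> t) < \<infinity>"
    using fin by (intro order.strict_trans1[OF bound]) (simp add: ennreal_mult_less_top)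
  then show "heat_flow \<mu> t \<in> Lq_U q"
    using bounded_in_Lq_loc[OF borel_measurable_heat_flow[OF loc] abs_heat_flow_le_uniform[OF \<mu> t] q]
    by (simp add: Lq_U_def)
next
  fix \<mu> :: "'a signed_measure" and t\<^sub>0 t :: real
  assume "\<mu> \<in> M_0" "0 < t\<^sub>0" "nonneg_measure \<mu>" "heat_flow \<mu> t\<^sub>0 \<in> Lq \<infinity> UNIV"
  then show \<mu>: "\<mu> \<in> M_U" by (intro M_U_if_heat_flow_bounded)
  assume "0 < t"
  with \<mu> show "heat_flow \<mu> t \<in> Lq \<infinity> UNIV" by (rule heat_flow_in_L_infinity)
qed

end
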